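(* Let $X$ be a (Hausdorff) topological space. If $X$ is $k^*$-metrizable, then $X$ has a metric $\rho$ (on the underlying set of $X$) such that (a) each compact subset $K\subset X$ is totally bounded with respect to $\rho$; (b) each $\rho$-convergent sequence converges in $X$; (c) a $\rho$-Cauchy sequence converges in $X$ if and only if it has a convergent subsequence in $X$. Conversely, if $X$ is sequentially regular and has a metric $\rho$ satisfying (a), (b), (c), then $X$ is $k^*$-metrizable.
   Context: All topological spaces are Hausdorff; "map" means continuous function. A subset is precompact if its closure is compact. A map $f:M\to X$ is subproper if there is $Z\subset M$ with $f(Z)=X$ such that $Z\cap f^{-1}(K)$ is precompact in $M$ for every precompact $K\subset X$. A space is $k^*$-metrizable if it is the image of a metrizable space under a subproper map. For $A\subset X$, $\mathrm{cl}_1(A)$ denotes the set of limits of all sequences $(a_n)\subset A$ that converge in $X$. $X$ is sequentially regular if for each point $x\in X$ and neighborhood $U$ of $x$ there is a neighborhood $V$ of $x$ with $\mathrm{cl}_1(V)\subset U$. "Compact subset" and "converges in $X$" refer to the topology of $X$. *)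

theory Defs
  imports "HOL-Analysis.Analysis"
begin

definition precompactin :: "'a topology \<Rightarrow> 'a set \<Rightarrow> bool" where
  "precompactin X A \<longleftrightarrow> A \<subseteq> topspace X \<and> compactin X (X closure_of A)"

definition subproper_map :: "'m topology \<Rightarrow> 'a topology \<Rightarrow> ('m \<Rightarrow> 'a) \<Rightarrow> bool" where
  "subproper_map M X f \<longleftrightarrow> continuous_map M X f \<and>
     (\<exists>Z. Z \<subseteq> topspace M \<and> f ` Z = topspace X \<and>
       (\<forall>K. precompactin X K \<longrightarrow> precompactin M (Z \<inter> {z \<in> topspace M. f z \<in> K})))"

text \<open>HOL cannot quantify existentially over the type carrying the metrizable space, so the
  definition fixes the type \<open>nat \<Rightarrow> 'a\<close>. This loses no generality: by
  \<open>kstar_metrizableI\<close> below, a subproper map from a metrizable space of any type whatsoever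
  witnesses \<open>kstar_metrizable\<close>.  Surjectivity is part of \<open>subproper_map\<close>.\<close>

definition kstar_metrizable :: "'a topology \<Rightarrow> bool" where
  "kstar_metrizable X \<longleftrightarrow>
     (\<exists>(M :: (nat \<Rightarrow> 'a) topology) f. metrizable_space M \<and> subproper_map M X f)"

definition convergentin :: "'a topology \<Rightarrow> (nat \<Rightarrow> 'a) \<Rightarrow> bool" where
  "convergentin X \<sigma> \<longleftrightarrow> (\<exists>l. limitin X \<sigma> l sequentially)"

definition cl1 :: "'a topology \<Rightarrow> 'a set \<Rightarrow> 'a set" where
  "cl1 X A = {x. \<exists>\<sigma>. range \<sigma> \<subseteq> A \<and> limitin X \<sigma> x sequentially}"

text \<open>Neighborhoods of a point need not be open.\<close>

definition nbhdin :: "'a topology \<Rightarrow> 'a \<Rightarrow> 'a set \<Rightarrow> bool" where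
  "nbhdin X x U \<longleftrightarrow> U \<subseteq> topspace X \<and> x \<in> X interior_of U"

definition sequentially_regular :: "'a topology \<Rightarrow> bool" where
  "sequentially_regular X \<longleftrightarrow>
     (\<forall>x \<in> topspace X. \<forall>U. nbhdin X x U \<longrightarrow> (\<exists>V. nbhdin X x V \<and> cl1 X V \<subseteq> U))"

definition compacts_totally_bounded :: "'a topology \<Rightarrow> ('a \<Rightarrow> 'a \<Rightarrow> real) \<Rightarrow> bool" where
  "compacts_totally_bounded X \<rho> \<longleftrightarrow>
     (\<forall>K. compactin X K \<longrightarrow> Metric_space.mtotally_bounded (topspace X) \<rho> K)"

definition metric_convergent_imp_convergent :: "'a topology \<Rightarrow> ('a \<Rightarrow> 'a \<Rightarrow> real) \<Rightarrow> bool" where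
  "metric_convergent_imp_convergent X \<rho> \<longleftrightarrow>
     (\<forall>\<sigma>. range \<sigma> \<subseteq> topspace X \<and> convergentin (Metric_space.mtopology (topspace X) \<rho>) \<sigma>
        \<longrightarrow> convergentin X \<sigma>)"

definition Cauchy_convergent_iff_subseq :: "'a topology \<Rightarrow> ('a \<Rightarrow> 'a \<Rightarrow> real) \<Rightarrow> bool" where
  "Cauchy_convergent_iff_subseq X \<rho> \<longleftrightarrow>
     (\<forall>\<sigma>. Metric_space.MCauchy (topspace X) \<rho> \<sigma> \<longrightarrow>
        (convergentin X \<sigma> \<longleftrightarrow> (\<exists>r. strict_mono r \<and> convergentin X (\<sigma> \<circ> r))))"

lemma precompactin_subset:
  assumes "precompactin X A" "B \<subseteq> A"
  shows "precompactin X B"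
  using assms unfolding precompactin_def
  by (meson closed_compactin closedin_closure_of closure_of_mono order_trans)

lemma metrizable_closure_sequence:
  assumes "metrizable_space M" "x \<in> M closure_of S"
  shows "\<exists>\<sigma>. range \<sigma> \<subseteq> S \<and> limitin M \<sigma> x sequentially"
proof -
  obtain C d where "Metric_space C d" and M: "M = Metric_space.mtopology C d"
    using assms(1) unfolding metrizable_space_def by blast
  then interpret Metric_space C d by simp
  show ?thesis using assms(2) unfolding M closure_of_sequentially by auto
qed

theorem kstar_metrizableI:
  fixes M :: "'m topology" and X :: "'a topology"
  assumes M: "metrizable_space M" and f: "subproper_map M X f"
  shows "kstar_metrizable X"
proof -
  obtain Z where contf: "continuous_map M X f" and ZM: "Z \<subseteq> topspace M" and fZ: "f ` Z = topspace X"
    and ZK: "\<And>K. precompactin X K \<Longrightarrow> precompactin M (Z \<inter> {z \<in> topspace M. f z \<in> K})"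
    using f unfolding subproper_map_def by metis
  define s where "s = inv_into Z f"
  have s: "s x \<in> Z" "f (s x) = x" if "x \<in> topspace X" for x
    using that fZ unfolding s_def by (metis inv_into_into, metis f_inv_into_f)
  define Z' where "Z' = s ` topspace X"
  have Z'Z: "Z' \<subseteq> Z" and Z'M: "Z' \<subseteq> topspace M"
    using s ZM unfolding Z'_def by auto
  define C where "C = M closure_of Z'"
  have CM: "C \<subseteq> topspace M" and Z'C: "Z' \<subseteq> C"
    unfolding C_def by (rule closure_of_subset_topspace, rule closure_of_subset[OF Z'M])
  define P where "P c \<sigma> \<longleftrightarrow> range \<sigma> \<subseteq> topspace X \<and> limitin M (s \<circ> \<sigma>) c sequentially" for c \<sigma>
  have exP: "\<exists>\<sigma>. P c \<sigma>" if "c \<in> C" for c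
  proof -
    obtain \<tau> where t: "range \<tau> \<subseteq> Z'" "limitin M \<tau> c sequentially"
      using metrizable_closure_sequence[OF M] \<open>c \<in> C\<close> unfolding C_def by metis
    have "\<forall>n. \<exists>x. x \<in> topspace X \<and> \<tau> n = s x" using t(1) unfolding Z'_def by blast
    then obtain \<sigma> where "\<forall>n. \<sigma> n \<in> topspace X \<and> \<tau> n = s (\<sigma> n)" by metis
    then have "s \<circ> \<sigma> = \<tau>" "range \<sigma> \<subseteq> topspace X" by auto
    then show ?thesis using t unfolding P_def by metis
  qed
  define e where "e c = (SOME \<sigma>. P c \<sigma>)" for c
  have e: "P c (e c)" if "c \<in> C" for c
    unfolding e_def using someI_ex[OF exP[OF that]] .
  have inj: "inj_on e C"
  proof (rule inj_onI)
    fix c c' assume "c \<in> C" "c' \<in> C" "e c = e c'"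
    then have "limitin M (s \<circ> e c) c sequentially" "limitin M (s \<circ> e c) c' sequentially"
      using e unfolding P_def by metis+
    then show "c = c'"
      using limitin_Hausdorff_unique[OF _ _ _ metrizable_imp_Hausdorff_space[OF M]]
      by (metis trivial_limit_sequentially)
  qed
  define g where "g = inv_into C e"
  have ge: "g (e c) = c" if "c \<in> C" for c using that inj unfolding g_def by simp
  define S where "S = subtopology M C"
  have tS: "topspace S = C" unfolding S_def using CM by auto
  define N where "N = pullback_topology (e ` C) g S"
  have tN: "topspace N = e ` C"
    unfolding N_def topspace_pullback_topology tS using ge by auto
  have contg: "continuous_map N S g"
    using continuous_map_pullback[of S S id "e ` C" g] unfolding N_def by simp
  have conte: "continuous_map S N e"
    unfolding N_def
  proof (rule continuous_map_pullback')
    show "continuous_map S S (g \<circ> e)"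
      using continuous_map_eq[OF continuous_map_id, of S "g \<circ> e"] ge tS by simp
  qed (auto simp: tS)
  have hm: "homeomorphic_maps S N e g"
    unfolding homeomorphic_maps_def using conte contg ge tS tN by auto
  then have hom: "homeomorphic_map S N e"
    using homeomorphic_map_maps by blast
  have "metrizable_space S" unfolding S_def by (rule metrizable_space_subtopology[OF M])
  then have mN: "metrizable_space N"
    using homeomorphic_metrizable_space hm unfolding homeomorphic_space_def by metis
  have "subproper_map N X (f \<circ> g)"
    unfolding subproper_map_def
  proof (intro conjI exI[of _ "e ` Z'"] allI impI)
    have "continuous_map S X f" unfolding S_def by (rule continuous_map_from_subtopology[OF contf])
    then show "continuous_map N X (f \<circ> g)" by (rule continuous_map_compose[OF contg])
    show "e ` Z' \<subseteq> topspace N" using tN Z'C by auto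
    have "(f \<circ> g) ` e ` Z' = f ` Z'"
    proof -
      have "g ` e ` Z' = (\<lambda>z. z) ` Z'"
        unfolding image_image using ge Z'C by (intro image_cong) auto
      then show ?thesis by (metis image_comp image_ident)
    qed
    also have "\<dots> = topspace X" unfolding Z'_def image_image using s by simp
    finally show "(f \<circ> g) ` e ` Z' = topspace X" .
    fix K assume K: "precompactin X K"
    define B where "B = Z' \<inter> {z \<in> topspace M. f z \<in> K}"
    have BC: "B \<subseteq> C" using Z'C unfolding B_def by auto
    have "precompactin M B"
    proof (rule precompactin_subset[OF ZK[OF K]])
      show "B \<subseteq> Z \<inter> {z \<in> topspace M. f z \<in> K}" using Z'Z unfolding B_def by auto
    qed
    then have cB: "compactin M (M closure_of B)" unfolding precompactin_def by simp
    have "M closure_of B \<subseteq> C" unfolding C_def by (rule closure_of_mono) (simp add: B_def)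
    then have "S closure_of B = M closure_of B"
      unfolding S_def closure_of_subtopology[of M C B] using BC by (simp add: Int_absorb1)
    then have "compactin S (S closure_of B)"
      using cB \<open>M closure_of B \<subseteq> C\<close> unfolding S_def by (simp add: compactin_subtopology)
    then have "compactin N (N closure_of (e ` B))"
      using homeomorphic_map_closure_of[OF hom, of B] BC tS
        homeomorphic_map_compactness[OF hom closure_of_subset_topspace, of B] by simp
    then have pB: "precompactin N (e ` B)"
      unfolding precompactin_def using BC tN by auto
    have "e ` Z' \<inter> {z \<in> topspace N. (f \<circ> g) z \<in> K} \<subseteq> e ` B"
    proof
      fix y assume "y \<in> e ` Z' \<inter> {z \<in> topspace N. (f \<circ> g) z \<in> K}"
      then obtain z where z: "z \<in> Z'" "y = e z" "f (g (e z)) \<in> K" by auto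
      then have "g (e z) = z" using ge Z'C by auto
      then have "z \<in> B" using z Z'M unfolding B_def by auto
      then show "y \<in> e ` B" using z by blast
    qed
    then show "precompactin N (e ` Z' \<inter> {z \<in> topspace N. (f \<circ> g) z \<in> K})"
      by (rule precompactin_subset[OF pB])
  qed
  then show ?thesis using mN unfolding kstar_metrizable_def by blast
qed

end

theory Submission
  imports Defs
begin

text \<open>If \<open>f: M \<rightarrow> X\<close> is subproper with witness \<open>Z\<close>, choose a section \<open>s\<close> of \<open>f\<close> with values
  in \<open>Z\<close> and pull the metric of \<open>M\<close> back along \<open>s\<close>. Since \<open>s\<close> maps a compact set onto a
  precompact one, (a) holds; since \<open>f \<circ> s\<close> is the identity and \<open>f\<close> is continuous, so does (b).
  For (c), an \<open>X\<close>-convergent subsequence together with its limit is compact, so its image under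
  \<open>s\<close> accumulates in \<open>M\<close>; being Cauchy, the whole image sequence converges in \<open>M\<close>, and \<open>f\<close>
  carries its limit to \<open>X\<close> (\<open>kstar_metrizable_imp_metric\<close>).

  Conversely, let \<open>M\<close> consist of those points of the completion of \<open>(X, \<rho>)\<close> that are limits of
  a sequence converging in \<open>X\<close>, and let \<open>f\<close> send such a point to the limit in \<open>X\<close>. Interleaving
  two sequences with the same limit in the completion gives a Cauchy sequence with an
  \<open>X\<close>-convergent subsequence, so (c) forces both to have the same limit in \<open>X\<close>
  (\<open>asymptotic_Cauchy_sequences_same_limit\<close>), and \<open>f\<close> is well defined. Continuity of \<open>f\<close> is
  where sequential regularity enters: the points of \<open>X\<close> near \<open>z\<close> lie in a given neighborhood \<open>V\<close>
  of \<open>f z\<close>, so the values of \<open>f\<close> near \<open>z\<close> lie in \<open>cl1 X V\<close>.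

  The embedded copy of \<open>X\<close> witnesses that \<open>f\<close> is subproper. By (a) the image of a compact \<open>K\<close> has
  compact closure in the completion, and it remains to see that this closure lies in \<open>M\<close>: a
  \<open>\<rho>\<close>-Cauchy sequence in \<open>K\<close> must converge in \<open>X\<close>. By (c) a convergent subsequence is enough.
  A compact Hausdorff space need not be sequentially compact, but \<open>K\<close> is: its topology is coarser
  than that of a totally bounded metric, so every subset of \<open>K\<close> is Lindelof, and then points of \<open>K\<close>
  have countable neighborhood bases in \<open>K\<close>
  (\<open>hereditarily_Lindelof_compactin_convergent_subsequence\<close>).\<close>

section \<open>Convergent subsequences in compact sets\<close>

text \<open>A totally bounded set is covered by countably many balls with centres in finite nets and
  radii tending to zero such that each point has arbitrarily small balls of this kind around it. Those
  contained in some member of the cover already suffice, and one member is kept for each.\<close>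

lemma (in Metric_space) mtotally_bounded_countable_subcover:
  assumes S: "mtotally_bounded S"
    and op: "\<And>U. U \<in> \<U> \<Longrightarrow> openin mtopology U" and cov: "S \<subseteq> \<Union>\<U>"
  obtains \<V> where "countable \<V>" "\<V> \<subseteq> \<U>" "S \<subseteq> \<Union>\<V>"
proof -
  have "\<forall>k. \<exists>F. finite F \<and> F \<subseteq> S \<and> S \<subseteq> (\<Union>x\<in>F. mball x (inverse (real (Suc k))))"
    using S unfolding mtotally_bounded_def by simp
  then obtain F where F: "\<And>k. finite (F k)" 
      "\<And>k. F k \<subseteq> S" "\<And>k. S \<subseteq> (\<Union>x\<in>F k. mball x (inverse (real (Suc k))))"
    by metis
  define I where "I = {(c, k). c \<in> F k \<and> (\<exists>U\<in>\<U>. mball c (inverse (real (Suc k))) \<subseteq> U)}"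
  have "\<forall>p\<in>I. \<exists>U\<in>\<U>. mball (fst p) (inverse (real (Suc (snd p)))) \<subseteq> U"
    unfolding I_def by auto
  then obtain u where u: "\<And>p. p \<in> I \<Longrightarrow> u p \<in> \<U>"
      "\<And>p. p \<in> I \<Longrightarrow> mball (fst p) (inverse (real (Suc (snd p)))) \<subseteq> u p"
    by metis
  show thesis
  proof
    have "I \<subseteq> (\<Union>k. (\<lambda>c. (c, k)) ` F k)"
      unfolding I_def by auto
    moreover have "countable (\<Union>k. (\<lambda>c. (c, k)) ` F k)"
      using F(1) by (simp add: countable_finite)
    ultimately show "countable (u ` I)"
      by (meson countable_image countable_subset)
    show "u ` I \<subseteq> \<U>" using u(1) by blast
    show "S \<subseteq> \<Union>(u ` I)"
    proof
      fix x assume "x \<in> S"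
      then obtain U where "U \<in> \<U>" "x \<in> U" using cov by blast
      then obtain \<epsilon> where "\<epsilon> > 0" and \<epsilon>: "mball x \<epsilon> \<subseteq> U"
        using op by (meson openin_mtopology)
      obtain k where k: "inverse (real (Suc k)) < \<epsilon> / 2"
        using reals_Archimedean[of "\<epsilon> / 2"] \<open>\<epsilon> > 0\<close> by auto
      obtain c where c: "c \<in> F k" "x \<in> mball c (inverse (real (Suc k)))"
        using F(3)[of k] \<open>x \<in> S\<close> by blast
      have "mball c (inverse (real (Suc k))) \<subseteq> mball x \<epsilon>"
      proof
        fix y assume y: "y \<in> mball c (inverse (real (Suc k)))"
        have "d x y \<le> d c x + d c y"
          using c y by (metis commute in_mball triangle)
        then show "y \<in> mball x \<epsilon>"
          using c y k by auto
      qed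
      then have "(c, k) \<in> I"
        using c \<epsilon> \<open>U \<in> \<U>\<close> unfolding I_def by blast
      then show "x \<in> \<Union>(u ` I)"
        using u(2)[of "(c, k)"] c by auto
    qed
  qed
qed

text \<open>Otherwise every point has a neighborhood that the sequence eventually avoids; finitely many of
  them cover \<open>K\<close>, so the sequence would eventually leave \<open>K\<close>.\<close>

lemma compactin_cluster_point:
  fixes \<sigma> :: "nat \<Rightarrow> 'a"
  assumes K: "compactin X K" and \<sigma>: "range \<sigma> \<subseteq> K"
  obtains y where "y \<in> K" "\<And>U N. openin X U \<Longrightarrow> y \<in> U \<Longrightarrow> \<exists>n\<ge>N. \<sigma> n \<in> U"
proof (rule ccontr)
  assume "\<not> thesis"
  then have "\<forall>y\<in>K. \<exists>U N. openin X U \<and> y \<in> U \<and> (\<forall>n\<ge>N. \<sigma> n \<notin> U)"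
    using that by metis
  then obtain U N where U: "\<And>y. y \<in> K \<Longrightarrow> openin X (U y)" "\<And>y. y \<in> K \<Longrightarrow> y \<in> U y"
      and N: "\<And>y n. y \<in> K \<Longrightarrow> n \<ge> N y \<Longrightarrow> \<sigma> n \<notin> U y"
    by metis
  have "(\<forall>V\<in>U ` K. openin X V) \<and> K \<subseteq> \<Union>(U ` K)"
    using U by auto
  then obtain \<F> where "finite \<F>" "\<F> \<subseteq> U ` K" "K \<subseteq> \<Union>\<F>"
    using K unfolding compactin_def by meson
  then obtain A where A: "finite A" "A \<subseteq> K" "K \<subseteq> \<Union>(U ` A)"
    by (metis finite_subset_image)
  define n where "n = sum N A"
  have "\<sigma> n \<in> K" using \<sigma> by blast
  then obtain a where "a \<in> A" "\<sigma> n \<in> U a" using A by blast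
  moreover have "N a \<le> n"
    unfolding n_def using \<open>a \<in> A\<close> A(1) by (simp add: member_le_sum)
  ultimately show False using N A(2) by blast
qed

text \<open>Let \<open>y\<close> be a cluster point. Since \<open>K - {y}\<close> is Lindelof, it is covered by countably many open
  sets \<open>U j\<close>, each disjoint from some neighborhood \<open>V j\<close> of \<open>y\<close>. A subsequence whose \<open>j\<close>-th term lies
  in \<open>V 0 \<inter> \<dots> \<inter> V j\<close> eventually avoids each \<open>U j\<close>. Outside a neighborhood of \<open>y\<close> the set \<open>K\<close>
  is covered by finitely many \<open>U j\<close>, hence the subsequence converges to \<open>y\<close>.\<close>

lemma hereditarily_Lindelof_compactin_convergent_subsequence:
  fixes \<sigma> :: "nat \<Rightarrow> 'a"
  assumes X: "Hausdorff_space X" and K: "compactin X K"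
    and Lind: "\<And>S. S \<subseteq> K \<Longrightarrow> Lindelof_space (subtopology X S)"
    and \<sigma>: "range \<sigma> \<subseteq> K"
  obtains l r where "strict_mono r" "limitin X (\<sigma> \<circ> r) l sequentially"
proof -
  have KX: "K \<subseteq> topspace X" using K by (rule compactin_subset_topspace)
  obtain y where "y \<in> K" and y: "\<And>U N. openin X U \<Longrightarrow> y \<in> U \<Longrightarrow> \<exists>n\<ge>N. \<sigma> n \<in> U"
    using compactin_cluster_point[OF K \<sigma>] by metis
  define \<U> where "\<U> = {U. openin X U \<and> (\<exists>V. openin X V \<and> y \<in> V \<and> disjnt U V)}"
  have "K - {y} \<subseteq> \<Union>\<U>"
  proof
    fix p assume "p \<in> K - {y}"
    then have "p \<in> topspace X" "y \<in> topspace X" "p \<noteq> y" using KX \<open>y \<in> K\<close> by auto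
    then obtain U V where "openin X U" "openin X V" "p \<in> U" "y \<in> V" "disjnt U V"
      using X unfolding Hausdorff_space_def by metis
    then show "p \<in> \<Union>\<U>" unfolding \<U>_def by blast
  qed
  moreover have "\<forall>U\<in>\<U>. openin X U" unfolding \<U>_def by blast
  moreover have "K - {y} \<subseteq> topspace X" using KX by blast
  ultimately obtain \<V> where \<V>: "countable \<V>" "\<V> \<subseteq> \<U>" "K - {y} \<subseteq> \<Union>\<V>"
    using Lind[of "K - {y}"] Lindelof_space_subtopology_subset[of "K - {y}" X] by (metis Diff_subset)
  \<comment> \<open>Adding the empty set makes the countable family nonempty, so that it can be enumerated.\<close>
  have "{} \<in> \<U>"
    using KX \<open>y \<in> K\<close> unfolding \<U>_def by (auto intro: exI[of _ "topspace X"])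
  define U where "U = from_nat_into (insert {} \<V>)"
  have rU: "range U = insert {} \<V>"
    unfolding U_def using \<V>(1) by (simp add: range_from_nat_into)
  then have U: "U j \<in> \<U>" for j using \<V>(2) \<open>{} \<in> \<U>\<close> rangeI[of U j] by auto
  then have "\<forall>j. \<exists>V. openin X V \<and> y \<in> V \<and> disjnt (U j) V" unfolding \<U>_def by blast
  then obtain V where V: "\<And>j. openin X (V j)" "\<And>j. y \<in> V j" "\<And>j. disjnt (U j) (V j)"
    by metis
  define W where "W j = (\<Inter>i\<le>j. V i)" for j
  have W: "openin X (W j)" "y \<in> W j" for j
    unfolding W_def using V by (auto intro!: openin_Inter)
  have "\<exists>r. \<forall>j. \<sigma> (r j) \<in> W j \<and> r j < r (Suc j)"
  proof (rule dependent_nat_choice)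
    show "\<exists>n. \<sigma> n \<in> W 0" using y[OF W] by blast
    fix n j
    show "\<exists>m. \<sigma> m \<in> W (Suc j) \<and> n < m"
      using y[OF W, of "Suc n" "Suc j"] by (auto simp: Suc_le_eq)
  qed
  then obtain r where rW: "\<And>j. \<sigma> (r j) \<in> W j" and "\<And>j. r j < r (Suc j)" by blast
  then have "strict_mono r" by (simp add: strict_mono_Suc_iff)
  moreover have "limitin X (\<sigma> \<circ> r) y sequentially"
    unfolding limitin_sequentially
  proof (intro conjI allI impI)
    show "y \<in> topspace X" using KX \<open>y \<in> K\<close> by blast
    fix G assume G: "openin X G \<and> y \<in> G"
    have cK: "compactin X (K - G)"
      by (rule closed_compactin[OF K]) (use compactin_imp_closedin[OF X K] G in auto)
    have "K - G \<subseteq> \<Union>(range U)" using \<V>(3) rU G by auto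
    moreover have "\<forall>A\<in>range U. openin X A"
      using U unfolding \<U>_def by blast
    ultimately obtain \<F> where "finite \<F>" "\<F> \<subseteq> range U" "K - G \<subseteq> \<Union>\<F>"
      using cK unfolding compactin_def by meson
    then obtain J where J: "finite J" "K - G \<subseteq> \<Union>(U ` J)"
      by (metis finite_subset_image)
    have "(\<sigma> \<circ> r) n \<in> G" if n: "sum id J \<le> n" for n
    proof (rule ccontr)
      assume "(\<sigma> \<circ> r) n \<notin> G"
      then have "\<sigma> (r n) \<in> K - G" using \<sigma> by auto
      then obtain j where "j \<in> J" "\<sigma> (r n) \<in> U j" using J(2) by blast
      moreover have "j \<le> n"
        using member_le_sum[of j J id] \<open>j \<in> J\<close> J(1) n by simp
      ultimately show False
        using rW[of n] V(3)[of j] unfolding W_def disjnt_def by auto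
    qed
    then show "\<exists>N. \<forall>n\<ge>N. (\<sigma> \<circ> r) n \<in> G" by blast
  qed
  ultimately show thesis using that by blast
qed

section \<open>From a subproper map to a metric\<close>

lemma kstar_metrizable_imp_metric:
  assumes X: "Hausdorff_space X" and kX: "kstar_metrizable X"
  shows "\<exists>\<rho>. Metric_space (topspace X) \<rho> \<and>
             compacts_totally_bounded X \<rho> \<and>
             metric_convergent_imp_convergent X \<rho> \<and>
             Cauchy_convergent_iff_subseq X \<rho>"
proof -
  obtain M :: "(nat \<Rightarrow> 'a) topology" and f where "metrizable_space M" and sp: "subproper_map M X f"
    using kX unfolding kstar_metrizable_def by blast
  then obtain C d where "Metric_space C d" and M: "M = Metric_space.mtopology C d"
    unfolding metrizable_space_def by blast
  interpret C: Metric_space C d by fact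
  obtain Z where contf: "continuous_map M X f" and ZM: "Z \<subseteq> topspace M" and fZ: "f ` Z = topspace X"
    and ZK: "\<And>K. precompactin X K \<Longrightarrow> precompactin M (Z \<inter> {z \<in> topspace M. f z \<in> K})"
    using sp unfolding subproper_map_def by metis
  define s where "s = inv_into Z f"
  have s: "s x \<in> Z" "f (s x) = x" if "x \<in> topspace X" for x
    using that fZ unfolding s_def by (metis inv_into_into, metis f_inv_into_f)
  then have sC: "s x \<in> C" if "x \<in> topspace X" for x
    using that ZM M by auto
  define \<rho> where "\<rho> x y = d (s x) (s y)" for x y
  interpret R: Metric_space "topspace X" \<rho>
  proof
    fix x y assume "x \<in> topspace X" "y \<in> topspace X"
    then show "(\<rho> x y = 0) = (x = y)"
      unfolding \<rho>_def using s sC by (metis C.zero)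
  qed (auto simp: \<rho>_def C.commute intro: C.triangle sC)
  have Cauchy_s: "C.MCauchy (s \<circ> \<sigma>)" if "R.MCauchy \<sigma>" for \<sigma>
    using that sC unfolding R.MCauchy_def C.MCauchy_def \<rho>_def by auto
  have Cauchy_s': "R.MCauchy \<sigma>" if "C.MCauchy (s \<circ> \<sigma>)" "range \<sigma> \<subseteq> topspace X" for \<sigma>
    using that unfolding R.MCauchy_def C.MCauchy_def \<rho>_def by auto
  \<comment> \<open>Limits in \<open>M\<close> need not lie in the image of \<open>s\<close>, but \<open>f\<close> is defined on all of \<open>M\<close>.\<close>
  have lim_f: "limitin X \<sigma> (f z) sequentially"
    if "range \<sigma> \<subseteq> topspace X" "limitin M (s \<circ> \<sigma>) z sequentially" for \<sigma> z
  proof -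
    have "limitin X (f \<circ> (s \<circ> \<sigma>)) (f z) sequentially"
      by (rule continuous_map_limit[OF contf that(2)])
    moreover have "f \<circ> (s \<circ> \<sigma>) = \<sigma>"
      using that(1) s by (simp add: fun_eq_iff image_subset_iff)
    ultimately show ?thesis by simp
  qed
  have section_compact: "compactin M (M closure_of (s ` K)) \<and> s ` K \<subseteq> C" if "compactin X K" for K
  proof -
    have KX: "K \<subseteq> topspace X" using compactin_subset_topspace[OF that] .
    have "precompactin X K"
      using that compactin_imp_closedin[OF X that] KX
      unfolding precompactin_def by (simp add: closure_of_closedin)
    then have "precompactin M (s ` K)"
      by (rule precompactin_subset[OF ZK]) (use s KX ZM in auto)
    then show ?thesis unfolding precompactin_def M by simp
  qed
  have "compacts_totally_bounded X \<rho>"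
    unfolding compacts_totally_bounded_def
  proof (intro allI impI)
    fix K assume K: "compactin X K"
    have KX: "K \<subseteq> topspace X" using compactin_subset_topspace[OF K] .
    have tb: "C.mtotally_bounded (s ` K)"
      using section_compact[OF K] C.compact_closure_of_imp_mtotally_bounded unfolding M by blast
    show "R.mtotally_bounded K"
      unfolding R.mtotally_bounded_sequentially
    proof (intro conjI allI impI)
      fix \<sigma> :: "nat \<Rightarrow> 'a" assume \<sigma>: "range \<sigma> \<subseteq> K"
      then have "range (s \<circ> \<sigma>) \<subseteq> s ` K" by auto
      then obtain r where "strict_mono r" "C.MCauchy (s \<circ> \<sigma> \<circ> r)"
        using tb unfolding C.mtotally_bounded_sequentially by blast
      moreover have "range (\<sigma> \<circ> r) \<subseteq> topspace X" using \<sigma> KX by auto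
      ultimately show "\<exists>r. strict_mono r \<and> R.MCauchy (\<sigma> \<circ> r)"
        using Cauchy_s'[of "\<sigma> \<circ> r"] by (auto simp: comp_assoc)
    qed (rule KX)
  qed
  moreover have "metric_convergent_imp_convergent X \<rho>"
    unfolding metric_convergent_imp_convergent_def
  proof (intro allI impI)
    fix \<sigma> assume "range \<sigma> \<subseteq> topspace X \<and> convergentin R.mtopology \<sigma>"
    then obtain x where \<sigma>: "range \<sigma> \<subseteq> topspace X" "limitin R.mtopology \<sigma> x sequentially"
      unfolding convergentin_def by blast
    then have "limitin M (s \<circ> \<sigma>) (s x) sequentially"
      unfolding M R.limit_metric_sequentially C.limit_metric_sequentially \<rho>_def
      using sC by (simp add: image_subset_iff)
    then show "convergentin X \<sigma>" using lim_f[OF \<sigma>(1)] unfolding convergentin_def by blast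
  qed
  moreover have "Cauchy_convergent_iff_subseq X \<rho>"
    unfolding Cauchy_convergent_iff_subseq_def
  proof (intro allI impI iffI)
    fix \<sigma> assume "convergentin X \<sigma>"
    then show "\<exists>r. strict_mono r \<and> convergentin X (\<sigma> \<circ> r)"
      by (intro exI[of _ id]) (auto simp: strict_mono_def)
  next
    fix \<sigma> assume \<sigma>: "R.MCauchy \<sigma>" and "\<exists>r. strict_mono r \<and> convergentin X (\<sigma> \<circ> r)"
    then obtain r l where r: "strict_mono r" and l: "limitin X (\<sigma> \<circ> r) l sequentially"
      unfolding convergentin_def by blast
    have rX: "range \<sigma> \<subseteq> topspace X" using \<sigma> unfolding R.MCauchy_def by simp
    define K where "K = insert l (range (\<sigma> \<circ> r))"
    have "compactin X K"
      unfolding K_def by (rule compactin_sequence_with_limit[OF l]) (use rX in auto)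
    then have cK: "compactin M (M closure_of (s ` K))" and "s ` K \<subseteq> C"
      using section_compact by blast+
    then have "s ` K \<subseteq> M closure_of (s ` K)"
      unfolding M by (intro closure_of_subset) simp
    then have "range (s \<circ> \<sigma> \<circ> r) \<subseteq> M closure_of (s ` K)" unfolding K_def by auto
    then obtain z q where q: "strict_mono q" "limitin M (s \<circ> \<sigma> \<circ> r \<circ> q) z sequentially"
      using cK unfolding M C.compactin_sequentially by blast
    have "limitin M (s \<circ> \<sigma>) z sequentially"
      unfolding M
    proof (rule C.MCauchy_convergent_subsequence[OF Cauchy_s[OF \<sigma>]])
      show "strict_mono (r \<circ> q)" using r q(1) by (rule strict_mono_o)
      show "limitin C.mtopology (s \<circ> \<sigma> \<circ> (r \<circ> q)) z sequentially"
        using q(2) unfolding M by (simp add: comp_assoc)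
    qed
    then show "convergentin X \<sigma>" using lim_f[OF rX] unfolding convergentin_def by blast
  qed
  ultimately show ?thesis using R.Metric_space_axioms by blast
qed

section \<open>From a metric to a subproper map\<close>

text \<open>The sequence alternating between \<open>\<sigma>\<close> and \<open>\<tau>\<close> is Cauchy and contains the convergent
  subsequence \<open>\<sigma>\<close>; the Cauchy criterion makes it converge, so all its subsequences share a limit.\<close>

lemma asymptotic_Cauchy_sequences_same_limit:
  assumes X: "Hausdorff_space X" and \<rho>: "Metric_space (topspace X) \<rho>"
    and c: "Cauchy_convergent_iff_subseq X \<rho>"
    and \<sigma>: "Metric_space.MCauchy (topspace X) \<rho> \<sigma>" and \<tau>: "Metric_space.MCauchy (topspace X) \<rho> \<tau>"
    and dist: "(\<lambda>n. \<rho> (\<sigma> n) (\<tau> n)) \<longlonglongrightarrow> 0"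
    and l: "limitin X \<sigma> l sequentially"
  shows "limitin X \<tau> l sequentially"
proof -
  interpret R: Metric_space "topspace X" \<rho> by fact
  define \<upsilon> where "\<upsilon> n = (if even n then \<sigma> (n div 2) else \<tau> (n div 2))" for n
  have "R.MCauchy \<upsilon>"
    unfolding \<upsilon>_def R.MCauchy_interleaving_gen using \<sigma> \<tau> dist by simp
  moreover have evens: "strict_mono (\<lambda>n::nat. 2 * n)" and odds: "strict_mono (\<lambda>n::nat. Suc (2 * n))"
    by (auto simp: strict_mono_def)
  moreover have e: "\<upsilon> \<circ> (\<lambda>n. 2 * n) = \<sigma>" and o: "\<upsilon> \<circ> (\<lambda>n. Suc (2 * n)) = \<tau>"
    unfolding \<upsilon>_def by auto
  ultimately have "convergentin X \<upsilon>"
    using c l unfolding Cauchy_convergent_iff_subseq_def convergentin_def by metis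
  then obtain m where m: "limitin X \<upsilon> m sequentially" unfolding convergentin_def by blast
  have "limitin X \<sigma> m sequentially" "limitin X \<tau> m sequentially"
    using limitin_subsequence[OF evens m] limitin_subsequence[OF odds m] e o by simp_all
  then show ?thesis
    using limitin_Hausdorff_unique[OF l _ _ X] by simp
qed

text \<open>A \<open>\<rho>\<close>-convergent sequence is asymptotic to the constant sequence at its limit, so it converges
  to the same point in \<open>X\<close>. Hence \<open>X\<close>-closed sets are sequentially closed, and thus closed, for
  \<open>\<rho>\<close>.\<close>

lemma Cauchy_criterion_imp_finer_metric_topology:
  assumes X: "Hausdorff_space X" and \<rho>: "Metric_space (topspace X) \<rho>"
    and c: "Cauchy_convergent_iff_subseq X \<rho>"
    and U: "openin X U"
  shows "openin (Metric_space.mtopology (topspace X) \<rho>) U"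
proof -
  interpret R: Metric_space "topspace X" \<rho> by fact
  define F where "F = topspace X - U"
  have F: "closedin X F" unfolding F_def using U by blast
  have "closedin R.mtopology F"
    unfolding R.metric_closedin_iff_sequentially_closed
  proof (intro conjI allI impI)
    show "F \<subseteq> topspace X" unfolding F_def by blast
    fix \<sigma> l assume a: "range \<sigma> \<subseteq> F \<and> limitin R.mtopology \<sigma> l sequentially"
    then have lX: "l \<in> topspace X" by (meson R.limitin_mspace)
    have rX: "range \<sigma> \<subseteq> topspace X" using a unfolding F_def by blast
    have "limitin X \<sigma> l sequentially"
    proof (rule asymptotic_Cauchy_sequences_same_limit[OF X \<rho> c])
      show "R.MCauchy (\<lambda>_. l)" using lX by simp
      show "R.MCauchy \<sigma>" using R.convergent_imp_MCauchy rX a by blast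
      have "(\<lambda>n. \<rho> (\<sigma> n) l) \<longlonglongrightarrow> 0"
        using a unfolding R.limitin_metric_dist_null by blast
      then show "(\<lambda>n. \<rho> l (\<sigma> n)) \<longlonglongrightarrow> 0" by (subst R.commute)
      show "limitin X (\<lambda>_. l) l sequentially" using lX by simp
    qed
    then show "l \<in> F"
      by (rule limitin_closedin[OF _ F]) (use a in \<open>auto simp: image_subset_iff\<close>)
  qed
  then have "openin R.mtopology (topspace X - F)" unfolding closedin_def by simp
  moreover have "topspace X - F = U" unfolding F_def using openin_subset[OF U] by blast
  ultimately show ?thesis by simp
qed

lemma compactin_convergent_subsequence_if_totally_bounded:
  fixes \<sigma> :: "nat \<Rightarrow> 'a"
  assumes X: "Hausdorff_space X" and \<rho>: "Metric_space (topspace X) \<rho>"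
    and a: "compacts_totally_bounded X \<rho>" and c: "Cauchy_convergent_iff_subseq X \<rho>"
    and K: "compactin X K" and \<sigma>: "range \<sigma> \<subseteq> K"
  obtains l r where "strict_mono r" "limitin X (\<sigma> \<circ> r) l sequentially"
proof (rule hereditarily_Lindelof_compactin_convergent_subsequence[OF X K _ \<sigma>])
  interpret R: Metric_space "topspace X" \<rho> by fact
  fix S assume "S \<subseteq> K"
  moreover have "R.mtotally_bounded K" using a K unfolding compacts_totally_bounded_def by blast
  ultimately have S: "R.mtotally_bounded S" using R.mtotally_bounded_subset by blast
  show "Lindelof_space (subtopology X S)"
    unfolding Lindelof_space_subtopology_subset[OF R.mtotally_bounded_imp_subset[OF S]]
  proof (intro allI impI)
    fix \<U> assume "(\<forall>U\<in>\<U>. openin X U) \<and> S \<subseteq> \<Union>\<U>"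
    then show "\<exists>V. countable V \<and> V \<subseteq> \<U> \<and> S \<subseteq> \<Union>V"
      using R.mtotally_bounded_countable_subcover[OF S, of \<U>]
        Cauchy_criterion_imp_finer_metric_topology[OF X \<rho> c] by metis
  qed
qed (use that in blast)

text \<open>In the proof, \<open>P z \<sigma>\<close> says that the sequence \<open>\<sigma>\<close> in \<open>X\<close> tends to the point \<open>z\<close> of the
  completion; \<open>T\<close> carries the metrizable space \<open>M\<close>, and \<open>f: T \<rightarrow> X\<close> is the subproper map.\<close>

lemma metric_imp_kstar_metrizable:
  assumes X: "Hausdorff_space X" and sr: "sequentially_regular X" and \<rho>: "Metric_space (topspace X) \<rho>"
    and a: "compacts_totally_bounded X \<rho>" and c: "Cauchy_convergent_iff_subseq X \<rho>"
  shows "kstar_metrizable X"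
proof -
  interpret R: Metric_space "topspace X" \<rho> by fact
  obtain i :: "'a \<Rightarrow> 'a \<Rightarrow> real" and m where "mcomplete_of m"
    and iC: "i \<in> topspace X \<rightarrow> mspace m"
    and iso: "\<And>x y. \<lbrakk>x \<in> topspace X; y \<in> topspace X\<rbrakk> \<Longrightarrow> mdist m (i x) (i y) = \<rho> x y"
    by (rule R.metric_completion) (rule that)
  interpret C: Metric_space "mspace m" "mdist m" by (rule Metric_space_mspace_mdist)
  have complete: "C.mcomplete" using \<open>mcomplete_of m\<close> unfolding mcomplete_of_def .
  have Cauchy_i: "R.MCauchy \<sigma> \<longleftrightarrow> C.MCauchy (i \<circ> \<sigma>)" if "range \<sigma> \<subseteq> topspace X" for \<sigma>
  proof -
    have "\<sigma> n \<in> topspace X" "i (\<sigma> n) \<in> mspace m" for n using that iC by auto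
    then show ?thesis
      unfolding R.MCauchy_def C.MCauchy_def by (simp add: image_subset_iff iso)
  qed
  define P where "P z \<sigma> \<longleftrightarrow> range \<sigma> \<subseteq> topspace X \<and> limitin C.mtopology (i \<circ> \<sigma>) z sequentially" for z \<sigma>
  have P_Cauchy: "R.MCauchy \<sigma>" if "P z \<sigma>" for z \<sigma>
  proof -
    have "range (i \<circ> \<sigma>) \<subseteq> mspace m" using that iC unfolding P_def by auto
    then show ?thesis using that Cauchy_i C.convergent_imp_MCauchy unfolding P_def by blast
  qed
  have P_asymptotic: "(\<lambda>n. \<rho> (\<sigma> n) (\<tau> n)) \<longlonglongrightarrow> 0" if P: "P z \<sigma>" "P z \<tau>" for z \<sigma> \<tau>
  proof (rule tendsto_sandwich[where f = "\<lambda>_. 0"])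
    have z: "z \<in> mspace m" using P C.limitin_mspace unfolding P_def by blast
    have "(\<lambda>n. mdist m ((i \<circ> \<sigma>) n) z) \<longlonglongrightarrow> 0" "(\<lambda>n. mdist m ((i \<circ> \<tau>) n) z) \<longlonglongrightarrow> 0"
      using P unfolding P_def C.limitin_metric_dist_null by auto
    from tendsto_add[OF this]
    show "(\<lambda>n. mdist m ((i \<circ> \<sigma>) n) z + mdist m ((i \<circ> \<tau>) n) z) \<longlonglongrightarrow> 0" by simp
    have "\<rho> (\<sigma> n) (\<tau> n) \<le> mdist m ((i \<circ> \<sigma>) n) z + mdist m ((i \<circ> \<tau>) n) z" for n
    proof -
      have "\<sigma> n \<in> topspace X" "\<tau> n \<in> topspace X" using P unfolding P_def by auto
      moreover from this have "i (\<sigma> n) \<in> mspace m" "i (\<tau> n) \<in> mspace m" using iC by auto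
      ultimately show ?thesis
        using iso C.triangle[of "i (\<sigma> n)" z "i (\<tau> n)"] z by (simp add: C.commute)
    qed
    then show "\<forall>\<^sub>F n in sequentially. \<rho> (\<sigma> n) (\<tau> n) \<le> mdist m ((i \<circ> \<sigma>) n) z + mdist m ((i \<circ> \<tau>) n) z"
      by simp
  qed auto
  define T where "T = {z. \<exists>\<sigma>. P z \<sigma> \<and> convergentin X \<sigma>}"
  define f where "f z = (SOME l. \<exists>\<sigma>. P z \<sigma> \<and> limitin X \<sigma> l sequentially)" for z
  have lim_f: "limitin X \<tau> (f z) sequentially" if "z \<in> T" "P z \<tau>" for z \<tau>
  proof -
    have "\<exists>l \<sigma>. P z \<sigma> \<and> limitin X \<sigma> l sequentially"
      using \<open>z \<in> T\<close> unfolding T_def convergentin_def by blast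
    then have "\<exists>\<sigma>. P z \<sigma> \<and> limitin X \<sigma> (f z) sequentially"
      unfolding f_def by (rule someI_ex)
    then show ?thesis
      using asymptotic_Cauchy_sequences_same_limit[OF X \<rho> c P_Cauchy P_Cauchy P_asymptotic] that(2)
      by blast
  qed
  have TC: "T \<subseteq> mspace m" unfolding T_def P_def using C.limitin_mspace by blast
  have Pi: "P (i x) (\<lambda>_. x)" if "x \<in> topspace X" for x
    using that iC unfolding P_def by (auto simp: o_def)
  have iT: "i x \<in> T" if "x \<in> topspace X" for x
  proof -
    have "limitin X (\<lambda>_. x) x sequentially" using that by simp
    then show ?thesis using Pi[OF that] unfolding T_def convergentin_def by blast
  qed
  have fi: "f (i x) = x" if "x \<in> topspace X" for x
    using limitin_Hausdorff_unique[OF lim_f[OF iT[OF that] Pi[OF that]] _ _ X, of x] that by simp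
  have fX: "f z \<in> topspace X" if "z \<in> T" for z
    using lim_f[OF that] that unfolding T_def by (blast intro: limitin_topspace)
  define M where "M = subtopology C.mtopology T"
  have tM: "topspace M = T" unfolding M_def using TC by auto
  \<comment> \<open>Otherwise points outside \<open>V\<close> would converge to \<open>z\<close>, and hence to \<open>f z\<close> in \<open>X\<close>.\<close>
  have ball: "\<exists>\<epsilon>>0. \<forall>x\<in>topspace X. i x \<in> C.mball z \<epsilon> \<longrightarrow> x \<in> V"
    if "z \<in> T" and V: "nbhdin X (f z) V" for z V
  proof (rule ccontr)
    assume "\<not> ?thesis"
    then have "\<forall>n. \<exists>x\<in>topspace X. i x \<in> C.mball z (inverse (real (Suc n))) \<and> x \<notin> V"
      by (metis inverse_positive_iff_positive of_nat_0_less_iff zero_less_Suc)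
    then obtain \<tau> where \<tau>: "\<And>n. \<tau> n \<in> topspace X" "\<And>n. i (\<tau> n) \<in> C.mball z (inverse (real (Suc n)))"
        "\<And>n. \<tau> n \<notin> V" by metis
    have "limitin C.mtopology (i \<circ> \<tau>) z sequentially"
      unfolding C.limit_metric_sequentially
    proof (intro conjI allI impI)
      show "z \<in> mspace m" using \<open>z \<in> T\<close> TC by blast
      fix \<epsilon> :: real assume "\<epsilon> > 0"
      then obtain N where N: "inverse (real (Suc N)) < \<epsilon>" using reals_Archimedean by blast
      have "mdist m (i (\<tau> n)) z < \<epsilon>" if "n \<ge> N" for n
      proof -
        have "inverse (real (Suc n)) \<le> inverse (real (Suc N))"
          using that by simp
        moreover have "mdist m z (i (\<tau> n)) < inverse (real (Suc n))"
          using \<tau>(2)[of n] by simp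
        ultimately show ?thesis
          using N C.commute[of "i (\<tau> n)" z] by linarith
      qed
      then show "\<exists>N. \<forall>n\<ge>N. (i \<circ> \<tau>) n \<in> mspace m \<and> mdist m ((i \<circ> \<tau>) n) z < \<epsilon>"
        using \<tau>(2) by auto
    qed
    then have "P z \<tau>" using \<tau>(1) unfolding P_def by auto
    then have "limitin X \<tau> (f z) sequentially" using lim_f \<open>z \<in> T\<close> by blast
    then have "\<exists>N. \<forall>n\<ge>N. \<tau> n \<in> X interior_of V"
      using V unfolding nbhdin_def limitin_sequentially by simp
    then show False using \<tau>(3) interior_of_subset[of X V] by blast
  qed
  have contf: "continuous_map M X f"
    unfolding continuous_map_eq_topcontinuous_at topcontinuous_at_def tM
  proof (intro ballI conjI allI impI)
    fix z U assume zT: "z \<in> T" and U: "openin X U \<and> f z \<in> U"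
    then have "nbhdin X (f z) U"
      unfolding nbhdin_def by (simp add: openin_subset interior_of_openin)
    then obtain V where V: "nbhdin X (f z) V" "cl1 X V \<subseteq> U"
      using sr fX[OF zT] unfolding sequentially_regular_def by blast
    obtain \<epsilon> where "\<epsilon> > 0" and \<epsilon>: "\<And>x. x \<in> topspace X \<Longrightarrow> i x \<in> C.mball z \<epsilon> \<Longrightarrow> x \<in> V"
      using ball[OF zT V(1)] by blast
    show "\<exists>W. openin M W \<and> z \<in> W \<and> (\<forall>y\<in>W. f y \<in> U)"
    proof (intro exI[of _ "T \<inter> C.mball z \<epsilon>"] conjI ballI)
      show "openin M (T \<inter> C.mball z \<epsilon>)"
        unfolding M_def by (simp add: openin_subtopology_Int2)
      show "z \<in> T \<inter> C.mball z \<epsilon>" using zT TC \<open>\<epsilon> > 0\<close> by auto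
      fix y assume y: "y \<in> T \<inter> C.mball z \<epsilon>"
      then obtain \<sigma> where \<sigma>: "P y \<sigma>" unfolding T_def by blast
      then have "limitin C.mtopology (i \<circ> \<sigma>) y sequentially" unfolding P_def by blast
      then obtain N where N: "\<And>n. n \<ge> N \<Longrightarrow> i (\<sigma> n) \<in> C.mball z \<epsilon>"
        using y unfolding limitin_sequentially by (metis C.openin_mball IntD2 comp_apply)
      \<comment> \<open>Since \<open>cl1\<close> asks for all terms to lie in \<open>V\<close>, the first \<open>N\<close> terms are dropped.\<close>
      have "range (\<lambda>n. \<sigma> (n + N)) \<subseteq> V"
        using \<epsilon> N \<sigma> unfolding P_def by (simp add: image_subset_iff del: C.in_mball)
      moreover have "limitin X (\<lambda>n. \<sigma> (n + N)) (f y) sequentially"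
        using limitin_sequentially_offset[OF lim_f[OF _ \<sigma>]] y by blast
      ultimately have "f y \<in> cl1 X V" unfolding cl1_def by blast
      then show "f y \<in> U" using V(2) by blast
    qed
  qed (use fX in auto)
  have "subproper_map M X f"
    unfolding subproper_map_def
  proof (intro conjI exI[of _ "i ` topspace X"] allI impI)
    show "continuous_map M X f" by (rule contf)
    show "i ` topspace X \<subseteq> topspace M" using iT tM by blast
    show "f ` i ` topspace X = topspace X" using fi by (simp add: image_image)
    fix K assume K: "precompactin X K"
    define L where "L = X closure_of K"
    have L: "compactin X L" "K \<subseteq> L"
      using K closure_of_subset unfolding precompactin_def L_def by blast+
    have LX: "L \<subseteq> topspace X" using compactin_subset_topspace[OF L(1)] .
    have "R.mtotally_bounded L" using a L(1) unfolding compacts_totally_bounded_def by blast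
    then have "C.mtotally_bounded (i ` L)"
      unfolding R.mtotally_bounded_sequentially C.mtotally_bounded_sequentially
    proof (intro conjI allI impI; elim conjE)
      show "i ` L \<subseteq> mspace m" using LX iC by auto
      fix \<tau> :: "nat \<Rightarrow> 'a \<Rightarrow> real" assume "range \<tau> \<subseteq> i ` L"
        and cs: "\<forall>\<sigma>::nat \<Rightarrow> 'a. range \<sigma> \<subseteq> L \<longrightarrow> (\<exists>r. strict_mono r \<and> R.MCauchy (\<sigma> \<circ> r))"
      then have "\<forall>n. \<exists>x\<in>L. \<tau> n = i x" by blast
      then obtain \<sigma> where \<sigma>: "\<And>n. \<sigma> n \<in> L" "\<And>n. \<tau> n = i (\<sigma> n)" by metis
      then obtain r where r: "strict_mono r" "R.MCauchy (\<sigma> \<circ> r)"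
        using cs by (metis image_subsetI)
      have "\<tau> \<circ> r = i \<circ> (\<sigma> \<circ> r)" using \<sigma>(2) by auto
      moreover have "range (\<sigma> \<circ> r) \<subseteq> topspace X" using \<sigma>(1) LX by auto
      ultimately show "\<exists>r. strict_mono r \<and> C.MCauchy (\<tau> \<circ> r)" using r Cauchy_i by metis
    qed
    then have cpt: "compactin C.mtopology (C.mtopology closure_of (i ` L))"
      using C.mtotally_bounded_eq_compact_closure_of[OF complete] by blast
    \<comment> \<open>The closure in the completion does not leave \<open>T\<close>, so compactness passes to \<open>M\<close>.\<close>
    have cT: "C.mtopology closure_of (i ` L) \<subseteq> T"
    proof
      fix z assume "z \<in> C.mtopology closure_of (i ` L)"
      then obtain \<tau> where \<tau>: "range \<tau> \<subseteq> i ` L" "limitin C.mtopology \<tau> z sequentially"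
        unfolding C.closure_of_sequentially by blast
      then have "\<forall>n. \<exists>x\<in>L. \<tau> n = i x" by blast
      then obtain \<sigma> where \<sigma>: "\<And>n. \<sigma> n \<in> L" "\<And>n. \<tau> n = i (\<sigma> n)" by metis
      then have "i \<circ> \<sigma> = \<tau>" "range \<sigma> \<subseteq> L" by auto
      then have P: "P z \<sigma>" using \<tau>(2) LX unfolding P_def by auto
      obtain r l where "strict_mono r" "limitin X (\<sigma> \<circ> r) l sequentially"
        using compactin_convergent_subsequence_if_totally_bounded[OF X \<rho> a c L(1) \<open>range \<sigma> \<subseteq> L\<close>] .
      then have "convergentin X \<sigma>"
        using c P_Cauchy[OF P] unfolding Cauchy_convergent_iff_subseq_def convergentin_def by blast
      then show "z \<in> T" using P unfolding T_def by blast
    qed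
    have "i ` L \<subseteq> T" using iT LX by blast
    then have "M closure_of (i ` L) = C.mtopology closure_of (i ` L)"
      unfolding M_def closure_of_subtopology using cT by (simp add: Int_absorb1)
    then have "precompactin M (i ` L)"
      unfolding precompactin_def using cpt cT \<open>i ` L \<subseteq> T\<close> tM
      by (simp add: M_def compactin_subtopology)
    moreover have "i ` topspace X \<inter> {z \<in> topspace M. f z \<in> K} \<subseteq> i ` L"
      using fi L(2) by auto
    ultimately show "precompactin M (i ` topspace X \<inter> {z \<in> topspace M. f z \<in> K})"
      by (rule precompactin_subset)
  qed
  moreover have "metrizable_space M"
    unfolding M_def using C.metrizable_space_mtopology by (rule metrizable_space_subtopology)
  ultimately show ?thesis using kstar_metrizableI by blast
qed

theorem theorem3p4:
  fixes X :: "'a topology"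
  assumes "Hausdorff_space X"
  shows "(kstar_metrizable X \<longrightarrow>
           (\<exists>\<rho>. Metric_space (topspace X) \<rho> \<and>
                compacts_totally_bounded X \<rho> \<and>
                metric_convergent_imp_convergent X \<rho> \<and>
                Cauchy_convergent_iff_subseq X \<rho>)) \<and>
         (sequentially_regular X \<and>
           (\<exists>\<rho>. Metric_space (topspace X) \<rho> \<and>
                compacts_totally_bounded X \<rho> \<and>
                metric_convergent_imp_convergent X \<rho> \<and>
                Cauchy_convergent_iff_subseq X \<rho>) \<longrightarrow>
          kstar_metrizable X)"
  using kstar_metrizable_imp_metric[OF assms] metric_imp_kstar_metrizable[OF assms] by blast

end
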